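(* Let $\mathcal Q$ be a quaternion division algebra with center $F$. Then the multiplicative group $\mathcal Q^*$ of $\mathcal Q$ has a maximal subgroup.
   Context: A quaternion division algebra over a field $F$ (of any characteristic) is a division algebra with center $F$ of dimension $4$ over $F$. A maximal subgroup of a group is a proper subgroup not contained in any other proper subgroup. *)

theory Defs
  imports Complex_Main "HOL-Algebra.Group"
begin

text \<open>The scalar field is the type \<open>'f\<close>; its copy inside the algebra is the set of all
  \<open>scale c 1\<close>. Since \<open>dim\<close> is \<open>0\<close> for a space without a finite basis, dimension \<open>4\<close> really means
  that there is a basis with four elements.\<close>

locale quaternion_division_algebra = vector_space scale
  for scale :: "'f::field \<Rightarrow> 'a::division_ring \<Rightarrow> 'a" +
  assumes mult_scale_left: "scale c x * y = scale c (x * y)"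
    and mult_scale_right: "x * scale c y = scale c (x * y)"
    and center_eq: "{z. \<forall>x. z * x = x * z} = range (\<lambda>c. scale c 1)"
    and dim_eq_4: "dim UNIV = 4"

definition multiplicative_group :: "'a::division_ring monoid" where
  "multiplicative_group = \<lparr>carrier = UNIV - {0}, monoid.mult = (*), one = 1\<rparr>"

lemma group_multiplicative_group: "group multiplicative_group"
  by (rule groupI)
     (auto simp: multiplicative_group_def mult.assoc intro!: bexI[of _ "inverse _"])

definition maximal_subgroup :: "'a set \<Rightarrow> ('a, 'b) monoid_scheme \<Rightarrow> bool" where
  "maximal_subgroup H G \<longleftrightarrow>
     subgroup H G \<and> H \<noteq> carrier G \<and>
     (\<forall>K. subgroup K G \<and> K \<noteq> carrier G \<and> H \<subseteq> K \<longrightarrow> K = H)"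

end

theory Submission
  imports Defs
begin

text \<open>
  Let \<open>F\<close> be the center and \<open>N\<close> the reduced norm. The proof splits according to whether every
  nonzero quaternion has a square norm.

  If not, then the quaternions whose norm is a square form a proper subgroup that contains all
  squares. The quotient is a nontrivial vector space over the field with two elements, so there is
  even a subgroup of index two (\<open>ex_maximal_subgroup_if_squares\<close>).

  If all norms are squares, the algebra is very special (\<open>ex_hamilton_generators\<close>): it has
  Hamilton's generators \<open>i\<close> and \<open>j\<close> over a field in which sums of two squares are squares. As for
  the rotations of Euclidean space, Euler angles show that \<open>F(i)\<close> and \<open>F(j)\<close> generate the whole
  multiplicative group. These two fields are conjugate under \<open>i + j\<close>, so \<open>F(i)\<close> and the single
  element \<open>i + j\<close> generate the group (\<open>generated_by_centralizer_and_sum\<close>). A group generated by a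
  proper subgroup and one further element has a maximal subgroup by Zorn's lemma
  (\<open>ex_maximal_subgroup_if_generated\<close>).

  The structure theory that is needed comes from counting dimensions: the centralizer of a
  noncentral element has dimension two, so every element is quadratic over \<open>F\<close>
  (\<open>centralizer_eq_span\<close>). The norm is built in the same way in every characteristic, from a
  separable quadratic element (\<open>ex_reduced_norm\<close>).
\<close>

section \<open>Maximal subgroups from Zorn's lemma\<close>

context group
begin

text \<open>Zorn's lemma applies because an element outside every member of a chain is outside its union.\<close>

lemma ex_subgroup_maximal_avoiding:
  assumes "subgroup H G" "g \<notin> H"
  shows "\<exists>M. subgroup M G \<and> H \<subseteq> M \<and> g \<notin> M \<and>
             (\<forall>K. subgroup K G \<and> M \<subseteq> K \<and> g \<notin> K \<longrightarrow> K = M)"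
proof -
  define A where "A = {K. subgroup K G \<and> H \<subseteq> K \<and> g \<notin> K}"
  have "A \<noteq> {}"
    using assms by (auto simp: A_def)
  moreover have "\<Union>C \<in> A" if "C \<noteq> {}" "subset.chain A C" for C
  proof -
    have CA: "C \<subseteq> A" and lin: "\<And>X Y. X \<in> C \<Longrightarrow> Y \<in> C \<Longrightarrow> X \<subseteq> Y \<or> Y \<subseteq> X"
      using that(2) by (auto simp: subset.chain_def)
    have sub: "subgroup X G" if "X \<in> C" for X
      using CA that by (auto simp: A_def)
    have "subgroup (\<Union>C) G"
    proof (rule subgroupI)
      show "\<Union>C \<subseteq> carrier G"
        using sub subgroup.subset by blast
      show "\<Union>C \<noteq> {}"
        using \<open>C \<noteq> {}\<close> sub subgroup.one_closed by blast
      show "inv x \<in> \<Union>C" if "x \<in> \<Union>C" for x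
        using that subgroup.m_inv_closed[OF sub] by auto
      show "x \<otimes> y \<in> \<Union>C" if xy: "x \<in> \<Union>C" "y \<in> \<Union>C" for x y
      proof -
        obtain X Y where XY: "X \<in> C" "x \<in> X" "Y \<in> C" "y \<in> Y"
          using xy by blast
        with lin[of X Y] obtain Z where "Z \<in> C" "x \<in> Z" "y \<in> Z"
          by blast
        then show ?thesis
          using subgroup.m_closed[OF sub] by blast
      qed
    qed
    then show ?thesis
      using CA \<open>C \<noteq> {}\<close> by (auto simp: A_def)
  qed
  ultimately obtain M where "M \<in> A" "\<forall>K\<in>A. M \<subseteq> K \<longrightarrow> K = M"
    using subset_Zorn_nonempty[of A] by blast
  then show ?thesis
    by (intro exI[of _ M]) (auto simp: A_def)
qed

text \<open>Avoiding \<open>g\<close> is the same as being proper for a subgroup above \<open>H\<close>. This is the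
  group version of the existence of maximal ideals, with \<open>g\<close> in the place of the unit element.\<close>

lemma ex_maximal_subgroup_if_generated:
  assumes H: "subgroup H G" and g: "g \<notin> H" "g \<in> carrier G"
    and gen: "\<And>K. subgroup K G \<Longrightarrow> H \<subseteq> K \<Longrightarrow> g \<in> K \<Longrightarrow> K = carrier G"
  shows "\<exists>M. maximal_subgroup M G"
proof -
  obtain M where M: "subgroup M G" "H \<subseteq> M" "g \<notin> M"
      "\<And>K. subgroup K G \<Longrightarrow> M \<subseteq> K \<Longrightarrow> g \<notin> K \<Longrightarrow> K = M"
    using ex_subgroup_maximal_avoiding[OF H g(1)] by blast
  have "K = M" if "subgroup K G" "K \<noteq> carrier G" "M \<subseteq> K" for K
    using that gen[of K] M(2) M(4)[of K] by blast
  moreover have "M \<noteq> carrier G"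
    using M(3) g(2) by blast
  ultimately show ?thesis
    using M(1) unfolding maximal_subgroup_def by blast
qed

lemma mult_inv_cancel_left:
  assumes "x \<in> carrier G" "y \<in> carrier G"
  shows "x \<otimes> (inv x \<otimes> y) = y" "inv x \<otimes> (x \<otimes> y) = y"
  using assms by (simp_all flip: m_assoc)

text \<open>A group modulo a normal subgroup \<open>M\<close> that contains all squares is a vector space over the field
  with two elements. When \<open>M\<close> is maximal among the subgroups that avoid \<open>g\<close>, the class of \<open>g\<close> is
  the only element of order two in this quotient, so \<open>M\<close> has index two.\<close>

lemma ex_maximal_subgroup_if_squares:
  assumes H: "subgroup H G" "H \<noteq> carrier G"
    and sq: "\<And>x. x \<in> carrier G \<Longrightarrow> x \<otimes> x \<in> H"
  shows "\<exists>M. maximal_subgroup M G"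
proof -
  obtain g where g: "g \<in> carrier G" "g \<notin> H"
    using H subgroup.subset by blast
  obtain M where M: "subgroup M G" "H \<subseteq> M" "g \<notin> M"
    and max: "\<And>K. subgroup K G \<Longrightarrow> M \<subseteq> K \<Longrightarrow> g \<notin> K \<Longrightarrow> K = M"
    using ex_subgroup_maximal_avoiding[OF H(1) g(2)] by blast
  note Mc [simp] = subgroup.mem_carrier[OF M(1)]
  note Mm = subgroup.m_closed[OF M(1)] and Mi = subgroup.m_inv_closed[OF M(1)]
  have conj: "inv y \<otimes> m \<otimes> y \<in> M" if "y \<in> carrier G" "m \<in> M" for y m
  proof -
    have "inv y \<otimes> m \<otimes> y = (inv y \<otimes> inv y) \<otimes> ((y \<otimes> m) \<otimes> (y \<otimes> m)) \<otimes> inv m"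
      using that by (simp add: m_assoc mult_inv_cancel_left)
    moreover have "inv y \<otimes> inv y \<in> M" "(y \<otimes> m) \<otimes> (y \<otimes> m) \<in> M"
      using that sq M(2) by auto
    ultimately show ?thesis
      using that Mm Mi by simp
  qed
  have coset: "\<exists>m\<in>M. g = y \<otimes> m" if y: "y \<in> carrier G" "y \<notin> M" for y
  proof (rule ccontr)
    assume no: "\<not> ?thesis"
    define K where "K = M \<union> (\<lambda>m. y \<otimes> m) ` M"
    have yK: "y \<otimes> m \<in> K" if "m \<in> M" for m
      using that by (auto simp: K_def)
    have yy: "y \<otimes> y \<in> M"
      using sq y M(2) by auto
    \<comment> \<open>\<open>M\<close> is normal and \<open>y \<otimes> y \<in> M\<close>, so two cosets already form a group.\<close>
    have "subgroup K G"
    proof (rule subgroupI)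
      show "K \<subseteq> carrier G"
        using y by (auto simp: K_def)
      show "K \<noteq> {}"
        using M(1) subgroup.one_closed by (auto simp: K_def)
      show "inv x \<in> K" if "x \<in> K" for x
      proof (cases "x \<in> M")
        case True
        then show ?thesis using Mi by (simp add: K_def)
      next
        case False
        then obtain m where m: "m \<in> M" "x = y \<otimes> m"
          using \<open>x \<in> K\<close> by (auto simp: K_def)
        have "inv x = y \<otimes> (inv (y \<otimes> y) \<otimes> (inv (inv y) \<otimes> inv m \<otimes> inv y))"
          using m y by (simp add: m_assoc inv_mult_group mult_inv_cancel_left)
        then show ?thesis
          using m y yy Mm Mi conj[of "inv y" "inv m"] yK by simp
      qed
      show "a \<otimes> c \<in> K" if ac: "a \<in> K" "c \<in> K" for a c
      proof -
        consider "a \<in> M" "c \<in> M" | m where "a = y \<otimes> m" "m \<in> M" "c \<in> M"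
          | m where "a \<in> M" "c = y \<otimes> m" "m \<in> M"
          | m n where "a = y \<otimes> m" "c = y \<otimes> n" "m \<in> M" "n \<in> M"
          using ac by (auto simp: K_def)
        then show ?thesis
        proof cases
          case 1
          then show ?thesis using Mm by (simp add: K_def)
        next
          case 2
          then show ?thesis using Mm y yK by (simp add: m_assoc)
        next
          case 3
          have "a \<otimes> c = y \<otimes> ((inv y \<otimes> a \<otimes> y) \<otimes> m)"
            using 3 y by (simp add: m_assoc mult_inv_cancel_left)
          then show ?thesis using 3 y Mm conj yK by simp
        next
          case 4
          have "a \<otimes> c = (y \<otimes> y) \<otimes> ((inv y \<otimes> m \<otimes> y) \<otimes> n)"
            using 4 y by (simp add: m_assoc mult_inv_cancel_left)
          then show ?thesis using 4 y Mm conj yy by (simp add: K_def)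
        qed
      qed
    qed
    moreover have "g \<notin> K" "M \<subseteq> K"
      using no M(3) by (auto simp: K_def)
    ultimately have "K = M"
      using max by blast
    then show False
      using yK[of \<one>] y subgroup.one_closed[OF M(1)] by simp
  qed
  have "K = carrier G" if K: "subgroup K G" "M \<subseteq> K" "g \<in> K" for K
  proof
    show "K \<subseteq> carrier G"
      using K(1) subgroup.subset by blast
    show "carrier G \<subseteq> K"
    proof
      fix y assume y: "y \<in> carrier G"
      show "y \<in> K"
      proof (cases "y \<in> M")
        case False
        then obtain m where "m \<in> M" "g = y \<otimes> m"
          using coset y by blast
        then have "y = g \<otimes> inv m"
          using y by (simp add: m_assoc)
        moreover have "inv m \<in> K"
          using K(2) \<open>m \<in> M\<close> subgroup.m_inv_closed[OF K(1)] by blast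
        ultimately show ?thesis
          using K(3) subgroup.m_closed[OF K(1)] by simp
      qed (use K in auto)
    qed
  qed
  then show ?thesis
    using ex_maximal_subgroup_if_generated[OF M(1) M(3) g(1)] by blast
qed

end

lemma subgroup_multiplicative_group_iff:
  fixes H :: "'b::division_ring set"
  shows "subgroup H multiplicative_group \<longleftrightarrow>
    0 \<notin> H \<and> 1 \<in> H \<and> (\<forall>x\<in>H. \<forall>y\<in>H. x * y \<in> H) \<and> (\<forall>x\<in>H. inverse x \<in> H)"
    (is "?L \<longleftrightarrow> ?R")
proof -
  have inv: "m_inv multiplicative_group x = inverse x" if "x \<noteq> 0" for x :: 'b
    using that by (intro group.inv_equality[OF group_multiplicative_group])
      (simp_all add: multiplicative_group_def)
  have "?L \<longleftrightarrow> H \<subseteq> carrier multiplicative_group \<and> 1 \<in> H \<and> (\<forall>x\<in>H. \<forall>y\<in>H. x * y \<in> H) \<and>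
      (\<forall>x\<in>H. m_inv multiplicative_group x \<in> H)"
    by (auto simp: subgroup_def multiplicative_group_def)
  also have "H \<subseteq> carrier multiplicative_group \<longleftrightarrow> 0 \<notin> H"
    by (auto simp: multiplicative_group_def)
  also have "(0 \<notin> H \<and> 1 \<in> H \<and> (\<forall>x\<in>H. \<forall>y\<in>H. x * y \<in> H) \<and>
      (\<forall>x\<in>H. m_inv multiplicative_group x \<in> H)) \<longleftrightarrow> ?R"
    by (intro conj_cong refl ball_cong) (metis inv)
  finally show ?thesis .
qed

section \<open>Quadratic elements and the quaternion basis\<close>

context quaternion_division_algebra
begin

lemma central_iff: "(\<forall>x. z * x = x * z) \<longleftrightarrow> (\<exists>c. z = scale c 1)"
  using center_eq by blast

lemma scale_one_mult: "scale c 1 * x = scale c x" "x * scale c 1 = scale c x"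
  by (simp_all add: mult_scale_left mult_scale_right)

lemma independent_card_le_4:
  assumes "independent S"
  shows "card S \<le> 4"
proof -
  obtain B where B: "independent B" "UNIV \<subseteq> span B" "card B = 4"
    using basis_exists[of UNIV] dim_eq_4 by metis
  then have "finite B"
    by (intro card_ge_0_finite) simp
  then show ?thesis
    using independent_span_bound[of B S] assms B by auto
qed

lemma commute_if_left_factor_commutes:
  fixes a u y :: 'a
  assumes "a * u = u * a" "(a * y) * u = u * (a * y)" "a \<noteq> 0"
  shows "y * u = u * y"
proof -
  have "a * (y * u) = a * (u * y)"
    using assms(1,2) by (metis mult.assoc)
  then show ?thesis
    using assms(3) by simp
qed

lemma not_in_span_one:
  assumes "u * y \<noteq> y * u"
  shows "u \<notin> span {1}"
proof
  assume "u \<in> span {1}"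
  then obtain c where "u = scale c 1"
    by (auto simp: span_breakdown_eq)
  then show False
    using assms by (simp add: scale_one_mult)
qed

text \<open>The span of \<open>S\<close> lies in the centralizer of \<open>u\<close>, which is a division ring that misses \<open>y\<close>. If a
  nonzero left multiple of \<open>y\<close> by this ring were in it again, then so would be \<open>y\<close>.\<close>

lemma independent_extend_centralizer:
  assumes "u * y \<noteq> y * u" "independent S" "\<forall>x\<in>S. x * u = u * x"
  shows "independent (insert (u * y) (insert y S))"
        "u * y \<notin> insert y S" "y \<notin> S"
proof -
  have comm: "x * u = u * x" if "x \<in> span S" for x
    using that
    by (induction rule: span_induct_alt)
       (simp_all add: distrib_left distrib_right mult_scale_left mult_scale_right assms(3))
  have y: "y \<notin> span S"
    using comm[of y] assms(1) by auto
  have uy: "u * y \<notin> span (insert y S)"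
  proof
    assume "u * y \<in> span (insert y S)"
    then obtain k where "u * y - scale k y \<in> span S"
      by (auto simp: span_breakdown_eq)
    then have "(u - scale k 1) * y \<in> span S"
      by (simp add: left_diff_distrib scale_one_mult)
    moreover have "u - scale k 1 \<noteq> 0"
      using assms(1) by (auto simp: scale_one_mult)
    moreover have "(u - scale k 1) * u = u * (u - scale k 1)"
      by (simp add: left_diff_distrib right_diff_distrib scale_one_mult)
    ultimately have "y * u = u * y"
      using commute_if_left_factor_commutes comm by blast
    then show False
      using assms(1) by simp
  qed
  show "independent (insert (u * y) (insert y S))"
    using y uy assms(2) by (intro independent_insertI)
  show "u * y \<notin> insert y S" "y \<notin> S"
    using y uy span_base by blast+
qed

lemma independent_pair:
  assumes "u * y \<noteq> y * u"
  shows "independent {u, 1}" "u \<noteq> 1"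
proof -
  have "1 \<notin> span {}"
    by simp
  then show "independent {u, 1}"
    using not_in_span_one[OF assms] independent_empty by (intro independent_insertI)
  show "u \<noteq> 1"
    using assms by auto
qed

text \<open>A third independent element of the centralizer would give, with \<open>y\<close> and \<open>u * y\<close>, five independent
  elements in a space of dimension four.\<close>

lemma centralizer_eq_span:
  assumes "u * y \<noteq> y * u" "v * u = u * v"
  shows "v \<in> span {u, 1}"
proof (rule ccontr)
  assume v: "v \<notin> span {u, 1}"
  note ind = independent_extend_centralizer[OF assms(1), of "{v, u, 1}"]
  have "independent {v, u, 1}"
    using v independent_pair(1)[OF assms(1)] by (rule independent_insertI)
  moreover have "\<forall>x\<in>{v, u, 1}. x * u = u * x"
    using assms(2) by simp
  ultimately have "independent {u * y, y, v, u, 1}" "u * y \<notin> {y, v, u, 1}" "y \<notin> {v, u, 1}"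
    using ind by blast+
  moreover have "v \<notin> {u, 1}"
    using v span_base[of v] by meson
  ultimately show False
    using independent_card_le_4[of "{u * y, y, v, u, 1}"] independent_pair(2)[OF assms(1)] by simp
qed

lemma centralizerE:
  assumes "u * y \<noteq> y * u" "v * u = u * v"
  obtains p q where "v = scale p 1 + scale q u"
proof -
  from centralizer_eq_span[OF assms] obtain p q where "v - scale q u = scale p 1"
    by (auto simp: span_breakdown_eq)
  then show thesis
    using that[of p q] by (simp add: algebra_simps)
qed

lemma quadratic:
  obtains t n where "u * u = scale t u - scale n 1"
proof (cases "\<forall>y. u * y = y * u")
  case True
  then obtain c where "u = scale c 1"
    using central_iff by blast
  then show thesis
    using that[of c 0] by (simp add: scale_one_mult)
next
  case False
  then obtain y where "u * y \<noteq> y * u"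
    by blast
  then obtain p q where "u * u = scale p 1 + scale q u"
    using centralizerE[of u y "u * u"] by (auto simp: mult.assoc)
  then show thesis
    using that[of q "- p"] by simp
qed

lemma quaternion_basis:
  assumes "u * y \<noteq> y * u"
  obtains p q r s where "x = scale p 1 + scale q u + (scale r y + scale s (u * y))"
proof -
  have ind: "independent {u * y, y, u, 1}" "u * y \<notin> {y, u, 1}" "y \<notin> {u, 1}"
    using independent_extend_centralizer[OF assms independent_pair(1)[OF assms]] by simp_all
  have "x \<in> span {u * y, y, u, 1}"
  proof (rule ccontr)
    assume x: "x \<notin> span {u * y, y, u, 1}"
    have "independent {x, u * y, y, u, 1}"
      using x ind(1) by (rule independent_insertI)
    moreover have "x \<notin> {u * y, y, u, 1}"
      using x span_base[of x] by meson
    ultimately show False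
      using independent_card_le_4[of "{x, u * y, y, u, 1}"] ind(2,3) independent_pair(2)[OF assms]
      by (simp only: card_insert_disjoint finite.intros) simp
  qed
  then obtain s r q p where "x - scale s (u * y) - scale r y - scale q u - scale p 1 = 0"
    unfolding span_breakdown_eq span_empty singleton_iff by blast
  then have "x = scale p 1 + scale q u + (scale r y + scale s (u * y))"
    by (simp only: diff_eq_eq add_0_left ac_simps)
  then show thesis
    using that by blast
qed

lemma quaternion_basis_unique:
  assumes uy: "u * y \<noteq> y * u"
    and eq: "scale p 1 + scale q u + (scale r y + scale s (u * y)) =
             scale p' 1 + scale q' u + (scale r' y + scale s' (u * y))"
  shows "p = p' \<and> q = q' \<and> r = r' \<and> s = s'"
proof -
  have L: "a = 0 \<and> b = 0" if "scale a 1 + scale b u = 0" for a b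
  proof -
    have "b = 0"
    proof (rule ccontr)
      assume "b \<noteq> 0"
      have "u = scale (- inverse b) (scale a 1)"
        using arg_cong[OF that, of "scale (inverse b)"] \<open>b \<noteq> 0\<close>
        by (simp add: scale_right_distrib eq_neg_iff_add_eq_0 add.commute)
      then show False
        using uy by (metis scale_one_mult scale_scale)
    qed
    then show ?thesis
      using that by simp
  qed
  define z where "z = scale (p - p') 1 + scale (q - q') u"
  define w where "w = scale (r - r') 1 + scale (s - s') u"
  have zw: "z + w * y = 0"
    using eq by (simp add: z_def w_def algebra_simps scale_one_mult mult_scale_left)
  have comm: "z * u = u * z" "w * u = u * w"
    by (simp_all add: z_def w_def algebra_simps scale_one_mult mult_scale_left mult_scale_right)
  have "w * y = - z"
    using zw by (simp add: eq_neg_iff_add_eq_0 add.commute)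
  then have "w = 0"
    using commute_if_left_factor_commutes[of w u y] comm uy by auto
  then have "z = 0"
    using zw by simp
  with \<open>w = 0\<close> show ?thesis
    using L[of "p - p'" "q - q'"] L[of "r - r'" "s - s'"] by (simp add: z_def w_def)
qed

text \<open>If every noncentral \<open>u\<close> were equal to its conjugate \<open>t - u\<close>, then the characteristic would be 2
  and every square would be central. But then \<open>x * y + y * x\<close> is always central, since it is the
  polarization of the square. Applied to \<open>x\<close> and \<open>x * y\<close>, this says that
  \<open>x * (x * y + y * x)\<close> is central, which forces \<open>x\<close> to be central or to commute with \<open>y\<close>.\<close>

lemma ex_separable:
  obtains u y t n where "u * y \<noteq> y * u" "u * u = scale t u - scale n 1" "u + u \<noteq> scale t 1"
proof -
  have "\<exists>u y t n. u * y \<noteq> y * u \<and> u * u = scale t u - scale n 1 \<and> u + u \<noteq> scale t 1"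
  proof (rule ccontr)
    assume "\<not> ?thesis"
    then have insep: "u + u = scale t 1" if "u * y \<noteq> y * u" "u * u = scale t u - scale n 1" for u y t n
      using that by blast
    obtain x y :: 'a where xy: "x * y \<noteq> y * x"
    proof -
      have "\<exists>x y :: 'a. x * y \<noteq> y * x"
      proof (rule ccontr)
        assume "\<not> ?thesis"
        then have "\<exists>c. x = scale c 1" for x
          using central_iff[of x] by blast
        then have "UNIV \<subseteq> span {1}"
          by (auto simp: span_singleton)
        then show False
          using dim_le_card[of UNIV "{1}"] dim_eq_4 by simp
      qed
      then show thesis using that by blast
    qed
    have char2: "(1 + 1 :: 'f) = 0"
    proof (rule ccontr)
      assume "(1 + 1 :: 'f) \<noteq> 0"
      obtain t n where "x * x = scale t x - scale n 1"
        using quadratic by blast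
      then have two_x: "scale (1 + 1) x = scale t 1"
        using insep[OF xy] by (simp only: scale_left_distrib scale_one)
      have "x = scale (inverse (1 + 1)) (scale (1 + 1) x)"
        by (simp only: scale_scale left_inverse[OF \<open>(1 + 1 :: 'f) \<noteq> 0\<close>] scale_one)
      then have "x = scale (inverse (1 + 1) * t) 1"
        by (simp only: two_x scale_scale)
      then show False
        using xy by (simp add: scale_one_mult)
    qed
    have two: "z + z = 0" for z :: 'a
    proof -
      have "z + z = scale (1 + 1) z"
        by (simp only: scale_left_distrib scale_one)
      then show ?thesis
        by (simp only: char2 scale_zero_left)
    qed
    have sq: "z * z * v = v * (z * z)" for z v :: 'a
    proof (cases "\<forall>y. z * y = y * z")
      case True
      then show ?thesis by (metis mult.assoc)
    next
      case False
      then obtain y where zy: "z * y \<noteq> y * z" by blast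
      obtain t n where tn: "z * z = scale t z - scale n 1"
        using quadratic by blast
      then have "scale t 1 = 0"
        using insep[OF zy tn] two by simp
      then show ?thesis
        using tn by (simp add: left_diff_distrib right_diff_distrib scale_one_mult)
    qed
    define c where "c = x * y + y * x"
    have central: "c * v = v * c" for v
    proof -
      have "c = (x + y) * (x + y) - x * x - y * y"
        by (simp add: c_def algebra_simps)
      then show ?thesis
        using sq by (simp add: left_diff_distrib right_diff_distrib)
    qed
    have "c \<noteq> 0"
      using xy two[of "y * x"] unfolding c_def by (metis add_right_cancel)
    have "x * c * v = v * (x * c)" for v
    proof -
      have "x * c = (x + x * y) * (x + x * y) - x * x - (x * y) * (x * y)"
        by (simp add: c_def algebra_simps)
      then show ?thesis
        using sq by (simp add: left_diff_distrib right_diff_distrib)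
    qed
    then have "x * y * c = y * x * c"
      using central by (metis mult.assoc)
    then show False
      using xy \<open>c \<noteq> 0\<close> by simp
  qed
  then show thesis
    using that by blast
qed

text \<open>In every characteristic the commutator \<open>j = u * y - y * u\<close> conjugates a quadratic element \<open>u\<close> to
  \<open>t - u\<close>. Its square commutes with \<open>u\<close>, so in the quadratic equation of \<open>j\<close>
  the linear term vanishes.\<close>

lemma quaternion_generators:
  obtains u j t n b where
    "u * j \<noteq> j * u"
    "u * u = scale t u - scale n 1" "j * u = scale t j - u * j" "j * j = scale b 1"
proof -
  obtain u y t n where uy: "u * y \<noteq> y * u" and uu: "u * u = scale t u - scale n 1"
    and sep: "u + u \<noteq> scale t 1"
    using ex_separable by blast
  define j where "j = u * y - y * u"
  have "j \<noteq> 0"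
    using uy by (simp add: j_def)
  have ju: "j * u = scale t j - u * j"
  proof -
    have "j * u + u * j = u * u * y - y * (u * u)"
      by (simp add: j_def left_diff_distrib right_diff_distrib mult.assoc)
    also have "\<dots> = scale t j"
      by (simp add: j_def uu left_diff_distrib right_diff_distrib scale_right_diff_distrib
          mult_scale_left mult_scale_right)
    finally show ?thesis
      by (simp add: eq_diff_eq)
  qed
  have uj: "u * j \<noteq> j * u"
  proof
    assume eq: "u * j = j * u"
    have "j * (u + u - scale t 1) = j * u + j * u - scale t j"
      by (simp add: distrib_left right_diff_distrib scale_one_mult)
    also have "\<dots> = 0"
      using ju eq by (simp add: eq_diff_eq)
    finally have "j * (u + u - scale t 1) = 0" .
    then show False
      using \<open>j \<noteq> 0\<close> sep by simp
  qed
  obtain t' n' where jj: "j * j = scale t' j - scale n' 1"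
    using quadratic by blast
  have "j * j * u = u * (j * j)"
  proof -
    have "j * (u * j) = (j * u) * j"
      by (simp only: mult.assoc)
    also have "\<dots> = scale t (j * j) - u * (j * j)"
      by (simp only: ju left_diff_distrib mult_scale_left mult.assoc)
    finally have juj: "j * (u * j) = scale t (j * j) - u * (j * j)" .
    have "j * j * u = j * (j * u)"
      by (simp only: mult.assoc)
    also have "\<dots> = scale t (j * j) - j * (u * j)"
      by (simp only: ju right_diff_distrib mult_scale_right)
    also have "\<dots> = u * (j * j)"
      by (simp add: juj)
    finally show ?thesis .
  qed
  then have "scale t' (j * u) = scale t' (u * j)"
    by (simp add: jj algebra_simps mult_scale_left mult_scale_right)
  then have "t' = 0"
    using uj by (auto simp: scale_cancel_left)
  then have "j * j = scale (- n') 1"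
    using jj by simp
  then show thesis
    using that uj uu ju by blast
qed

section \<open>The reduced norm\<close>

text \<open>The relation for \<open>j * u\<close> says that \<open>j\<close> acts on \<open>F(u)\<close> by the conjugation \<open>\<sigma>\<close> with
  \<open>\<sigma> u = t - u\<close>. The coefficients below are those of
  \<open>(z + w j) (z' + w' j) = (z z' + b w \<sigma>(w')) + (z w' + w \<sigma>(z')) j\<close>.\<close>

lemma quaternion_mult:
  assumes uu: "u * u = scale t u - scale n 1" and ju: "j * u = scale t j - u * j"
    and jj: "j * j = scale b 1"
  shows "(scale p 1 + scale q u + (scale r j + scale s (u * j))) *
         (scale p' 1 + scale q' u + (scale r' j + scale s' (u * j))) =
         scale (p * p' - n * q * q' + b * (r * r' + t * r * s' + n * s * s')) 1 +
         scale (p * q' + q * p' + t * q * q' + b * (s * r' - r * s')) u +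
         (scale (p * r' - n * q * s' + r * p' + t * r * q' + n * s * q') j +
          scale (p * s' + q * r' + t * q * s' - r * q' + s * p') (u * j))"
proof -
  define w where "w = u * j"
  have uw: "u * w = scale t w - scale n j"
  proof -
    have "u * w = (u * u) * j"
      by (simp only: w_def mult.assoc)
    then show ?thesis
      by (simp only: uu left_diff_distrib mult_scale_left w_def mult_1_left)
  qed
  have jw: "j * w = scale (t * b) 1 - scale b u"
  proof -
    have "j * w = (j * u) * j"
      by (simp only: w_def mult.assoc)
    then show ?thesis
      by (simp only: ju left_diff_distrib mult_scale_left mult_scale_right mult.assoc jj
          scale_scale mult_1_right)
  qed
  have wu: "w * u = scale n j"
  proof -
    have "w * u = u * (j * u)"
      by (simp only: w_def mult.assoc)
    also have "\<dots> = scale t w - u * w"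
      by (simp only: ju right_diff_distrib mult_scale_right w_def)
    finally show ?thesis
      by (simp add: uw)
  qed
  have wj: "w * j = scale b u"
    by (simp only: w_def mult.assoc jj mult_scale_right mult_1_right)
  have ww: "w * w = scale (n * b) 1"
  proof -
    have "w * w = (w * u) * j"
      by (simp only: w_def mult.assoc)
    then show ?thesis
      by (simp only: wu mult_scale_left jj scale_scale)
  qed
  have ju': "j * u = scale t j - w"
    by (simp only: ju w_def)
  show ?thesis
    unfolding w_def[symmetric]
    by (simp add: distrib_left distrib_right mult_scale_left mult_scale_right
        uu ju' jj w_def[symmetric] uw jw wu wj ww scale_one_mult algebra_simps)
qed

text \<open>In the basis \<open>1, u, j, u * j\<close> the reduced norm is the quadratic form \<open>M\<close> below, that is, the norm
  form of \<open>F(u)\<close> minus \<open>b\<close> times itself. It is the constant term of the quadratic equation of \<open>x\<close>.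
  This second description does not mention the basis, and for a noncentral \<open>x\<close> it determines the
  norm because \<open>1\<close> and \<open>x\<close> are independent.\<close>

lemma ex_reduced_norm:
  obtains N :: "'a \<Rightarrow> 'f"
  where "\<And>x y. N (x * y) = N x * N y"
    and "\<And>x y t n. x * y \<noteq> y * x \<Longrightarrow> x * x = scale t x - scale n 1 \<Longrightarrow> N x = n"
proof -
  obtain u j t n b where uj: "u * j \<noteq> j * u"
    and uu: "u * u = scale t u - scale n 1" and ju: "j * u = scale t j - u * j"
    and jj: "j * j = scale b 1"
    using quaternion_generators by blast
  define X where "X = (\<lambda>(p, q, r, s). scale p 1 + scale q u + (scale r j + scale s (u * j)))"
  define M where "M = (\<lambda>(p, q, r, s).
    p * p + t * p * q + n * q * q - b * (r * r + t * r * s + n * s * s))"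
  have inj: "inj X"
    unfolding X_def inj_on_def using quaternion_basis_unique[OF uj] by auto
  have surj: "\<exists>p q r s. x = X (p, q, r, s)" for x
    unfolding X_def prod.case by (rule quaternion_basis[OF uj, of x]) blast
  define N where "N x = M (the_inv X x)" for x
  have N_X: "N (X c) = M c" for c
    by (simp add: N_def the_inv_f_f[OF inj])
  have mult: "N (x * y) = N x * N y" for x y
  proof -
    obtain p q r s p' q' r' s' where xy: "x = X (p, q, r, s)" "y = X (p', q', r', s')"
      using surj by metis
    have prod: "x * y = X (p * p' - n * q * q' + b * (r * r' + t * r * s' + n * s * s'),
                     p * q' + q * p' + t * q * q' + b * (s * r' - r * s'),
                     p * r' - n * q * s' + r * p' + t * r * q' + n * s * q',
                     p * s' + q * r' + t * q * s' - r * q' + s * p')"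
      unfolding xy X_def prod.case by (rule quaternion_mult[OF uu ju jj])
    show ?thesis
      unfolding prod unfolding xy N_X M_def prod.case by algebra
  qed
  have quad: "x * x = scale (p + p + t * q) x - scale (N x) 1" if x: "x = X (p, q, r, s)" for x p q r s
  proof -
    have coeffs:
      "p * p - n * q * q + b * (r * r + t * r * s + n * s * s) = (p + p + t * q) * p - M (p, q, r, s)"
      "p * q + q * p + t * q * q + b * (s * r - r * s) = (p + p + t * q) * q"
      "p * r - n * q * s + r * p + t * r * q + n * s * q = (p + p + t * q) * r"
      "p * s + q * r + t * q * s - r * q + s * p = (p + p + t * q) * s"
      unfolding M_def prod.case by algebra+
    show ?thesis
      unfolding x N_X unfolding X_def prod.case quaternion_mult[OF uu ju jj] coeffs
      by (simp add: scale_right_distrib scale_left_diff_distrib)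
  qed
  have "N x = n'" if xy: "x * y \<noteq> y * x" and xx: "x * x = scale t' x - scale n' 1" for x y t' n'
  proof -
    obtain p q r s where "x = X (p, q, r, s)"
      using surj by blast
    from quad[OF this] xx have "scale t' x - scale n' 1 = scale (p + p + t * q) x - scale (N x) 1"
      by simp
    then have "scale (- n') 1 + scale t' x + (scale 0 y + scale 0 (x * y)) =
               scale (- N x) 1 + scale (p + p + t * q) x + (scale 0 y + scale 0 (x * y))"
      by simp
    from quaternion_basis_unique[OF xy this] show ?thesis
      by simp
  qed
  with mult show thesis
    using that by blast
qed

section \<open>Algebras in which all norms are squares\<close>

text \<open>If all reduced norms are squares, the algebra looks like Hamilton's quaternions. The element
  \<open>u + u - t\<close> anticommutes with \<open>v\<close>, and each of the two has norm equal to minus its square.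
  Sums of two squares are squares, because \<open>a * a + b * b\<close> is the norm of \<open>a + b i\<close>.\<close>

lemma ex_hamilton_generators:
  fixes N :: "'a \<Rightarrow> 'f"
  assumes quad: "\<And>x y t n. x * y \<noteq> y * x \<Longrightarrow> x * x = scale t x - scale n 1 \<Longrightarrow> N x = n"
    and sq: "\<And>x. x \<noteq> 0 \<Longrightarrow> \<exists>c. N x = c * c"
  obtains i j :: 'a where "i * j \<noteq> j * i" "i * i = - 1" "j * j = - 1" "j * i = - (i * j)"
    "\<And>a b. \<exists>c. a * a + b * b = c * (c :: 'f)"
proof -
  obtain u v t n b where uv: "u * v \<noteq> v * u"
    and uu: "u * u = scale t u - scale n 1" and vu: "v * u = scale t v - u * v"
    and vv: "v * v = scale b 1"
    using quaternion_generators by blast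
  \<comment> \<open>A pure quaternion can be rescaled to have square \<open>-1\<close>, because its norm is a square.\<close>
  have root: "\<exists>r. r \<noteq> 0 \<and> scale (inverse r) x * scale (inverse r) x = - 1"
    if xy: "x * y \<noteq> y * x" and xx: "x * x = scale a 1" for x y a
  proof -
    have "x \<noteq> 0"
      using xy by auto
    have "N x = - a"
      using quad[of x y 0 "- a"] xy xx by simp
    then obtain r where r: "- a = r * r"
      using sq[OF \<open>x \<noteq> 0\<close>] by auto
    have "a \<noteq> 0"
      using xx \<open>x \<noteq> 0\<close> by auto
    then have "r \<noteq> 0"
      using r by auto
    have "scale (inverse r) x * scale (inverse r) x = scale (inverse r * inverse r * a) 1"
      by (simp add: mult_scale_left mult_scale_right xx)
    moreover have "inverse r * inverse r * a = - 1"
      using r \<open>r \<noteq> 0\<close> by (simp add: field_simps minus_equation_iff[of a])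
    ultimately show ?thesis
      using \<open>r \<noteq> 0\<close> by auto
  qed
  obtain s where s: "s \<noteq> 0" "scale (inverse s) v * scale (inverse s) v = - 1"
    using root[of v u b] uv vv by auto
  define j where "j = scale (inverse s) v"
  have jj: "j * j = - 1"
    using s by (simp add: j_def)
  have uj: "u * j \<noteq> j * u"
    using uv s(1) by (simp add: j_def mult_scale_left mult_scale_right scale_cancel_left)
  have scale_2: "scale 2 z = z + z" for z
    by (simp only: scale_left_distrib scale_one flip: one_add_one)
  \<comment> \<open>In characteristic 2 the equation \<open>j * j = - 1\<close> reads \<open>(j - 1) * (j + 1) = 0\<close> and makes \<open>j\<close> central.\<close>
  have two: "(2 :: 'f) \<noteq> 0"
  proof
    assume "(2 :: 'f) = 0"
    then have "(1 + 1 :: 'a) = 0"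
      using scale_2[of 1] by simp
    then have "(j - 1) * (j + 1) = 0"
      using jj by (simp add: algebra_simps add_eq_0_iff)
    then have "j = 1 \<or> j = - 1"
      by (auto simp: add_eq_0_iff2)
    then show False
      using uj by auto
  qed
  define i0 where "i0 = u + u - scale t 1"
  have "i0 * i0 = scale (t * t) 1 - scale n 1 - scale n 1 - scale n 1 - scale n 1"
    by (simp add: i0_def left_diff_distrib right_diff_distrib distrib_left distrib_right
        mult_scale_left mult_scale_right uu algebra_simps)
  then have i0i0: "i0 * i0 = scale (t * t - n - n - n - n) 1"
    by (simp only: scale_left_diff_distrib)
  have i0v: "i0 * v \<noteq> v * i0"
  proof
    assume "i0 * v = v * i0"
    then have "u * v + u * v - (v * u + v * u) = 0"
      by (simp add: i0_def left_diff_distrib right_diff_distrib distrib_left distrib_right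
          mult_scale_left mult_scale_right)
    then have "scale 2 (u * v - v * u) = 0"
      by (simp only: scale_2 add_diff_add)
    then show False
      using uv two by (simp add: scale_eq_0_iff)
  qed
  have vi0: "v * i0 = - (i0 * v)"
  proof -
    have "v * i0 + i0 * v = (v * u + u * v - scale t v) + (v * u + u * v - scale t v)"
      by (simp add: i0_def left_diff_distrib right_diff_distrib distrib_left distrib_right
          mult_scale_left mult_scale_right)
    also have "\<dots> = 0"
      by (simp add: vu)
    finally show ?thesis
      by (simp add: add_eq_0_iff)
  qed
  obtain r where r: "r \<noteq> 0" "scale (inverse r) i0 * scale (inverse r) i0 = - 1"
    using root[OF i0v i0i0] by auto
  define i where "i = scale (inverse r) i0"
  have ii: "i * i = - 1"
    using r by (simp add: i_def)
  have ij: "i * j \<noteq> j * i"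
    using i0v s(1) r(1) by (simp add: i_def j_def mult_scale_left mult_scale_right scale_cancel_left
        mult.commute)
  have ji: "j * i = - (i * j)"
    using vi0 by (simp add: i_def j_def mult_scale_left mult_scale_right mult.commute)
  have "\<exists>c. a * a + b * b = c * c" for a b :: 'f
  proof (cases "b = 0")
    case False
    define x where "x = scale a 1 + scale b i"
    have xj: "x * j \<noteq> j * x"
      using False ij by (simp add: x_def distrib_left distrib_right mult_scale_left mult_scale_right
          scale_cancel_left)
    have xx: "x * x = scale (a + a) x - scale (a * a + b * b) 1"
      by (simp add: x_def distrib_left distrib_right mult_scale_left mult_scale_right ii)
        (simp add: algebra_simps flip: scale_left_distrib)
    have "x \<noteq> 0"
      using xj by auto
    then show ?thesis
      using quad[OF xj xx] sq[of x] by simp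
  qed auto
  with ij ii jj ji show thesis
    using that by blast
qed

text \<open>This is the decomposition of a rotation by Euler angles, written algebraically. Every nonzero
  quaternion outside \<open>F(i) j\<close> is \<open>z (1 + v j)\<close> with \<open>z\<close> and \<open>v\<close> in \<open>F(i)\<close>. If the norm of \<open>v\<close> is
  the square of \<open>s\<close>, then conjugation by \<open>y = s + v'\<close>, where \<open>v'\<close> is the conjugate of \<open>v\<close>, turns \<open>1 + v j\<close> into \<open>1 + s j\<close>,
  because \<open>y v\<close> is \<open>s\<close> times the conjugate of \<open>y\<close> (Hilbert's Theorem 90). Finally \<open>F(j)\<close> is a conjugate of \<open>F(i)\<close>.\<close>

lemma generated_by_centralizer_and_sum:
  fixes i j :: 'a
  assumes ij: "i * j \<noteq> j * i" and ii: "i * i = - 1" and jj: "j * j = - 1"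
    and ji: "j * i = - (i * j)"
    and pyth: "\<And>a b. \<exists>c. a * a + b * b = c * (c :: 'f)"
    and K: "subgroup K multiplicative_group"
    and L: "{z. z \<noteq> 0 \<and> z * i = i * z} \<subseteq> K" and g: "i + j \<in> K"
  shows "K = carrier multiplicative_group"
proof -
  have K0: "0 \<notin> K" and K1: "1 \<in> K" and Km: "\<And>x y. x \<in> K \<Longrightarrow> y \<in> K \<Longrightarrow> x * y \<in> K"
    and Ki: "\<And>x. x \<in> K \<Longrightarrow> inverse x \<in> K"
    using K by (auto simp: subgroup_multiplicative_group_iff)
  have LK: "z \<in> K" if "z * i = i * z" "z \<noteq> 0" for z
    using L that by auto
  have conj: "x \<in> K" if "y * x = z * y" "y \<in> K" "z \<in> K" for x y z
  proof -
    have "y \<noteq> 0"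
      using that(2) K0 by auto
    then have "x = inverse y * (y * x)"
      by (simp flip: mult.assoc)
    also have "\<dots> = inverse y * (z * y)"
      by (simp only: that(1))
    finally show ?thesis
      using that Km Ki by simp
  qed
  \<comment> \<open>\<open>i + j\<close> conjugates \<open>i\<close> to \<open>j\<close>.\<close>
  have jK: "scale a 1 + scale b j \<in> K" if "scale a 1 + scale b i \<noteq> 0" for a b
  proof (rule conj)
    show "(i + j) * (scale a 1 + scale b j) = (scale a 1 + scale b i) * (i + j)"
      by (simp add: distrib_left distrib_right mult_scale_left mult_scale_right ii jj ji algebra_simps)
    show "scale a 1 + scale b i \<in> K"
      using that by (intro LK) (simp_all add: distrib_left distrib_right mult_scale_left mult_scale_right)
  qed (rule g)
  have lin0: "scale a 1 + scale b i \<noteq> 0" if "b \<noteq> 0" for a b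
  proof
    assume "scale a 1 + scale b i = 0"
    then have "(scale a 1 + scale b i) * j = j * (scale a 1 + scale b i)"
      by simp
    then show False
      using ij that by (simp add: distrib_left distrib_right mult_scale_left mult_scale_right scale_cancel_left)
  qed
  have j_in: "j \<in> K"
    using jK[of 0 1] lin0[of 1 0] by simp
  have unit: "1 + v * j \<in> K" if v: "v * i = i * v" "v \<noteq> 0" for v
  proof -
    obtain a b where ab: "v = scale a 1 + scale b i"
      using centralizerE[OF ij v(1)] by blast
    obtain s where s: "a * a + b * b = s * s"
      using pyth by blast
    define y where "y = scale (s + a) 1 - scale b i"
    have s_in: "1 + scale c j \<in> K" for c
      using jK[of 1 c] lin0[of c 1] by (cases "c = 0") simp_all
    show ?thesis
    proof (cases "y = 0")
      \<comment> \<open>Then \<open>v = - s\<close> is already a scalar.\<close>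
      case True
      have "b = 0"
        using True lin0[of "- b" "s + a"] by (auto simp: y_def)
      then show ?thesis
        using ab v(2) s_in[of a] by (auto simp: mult_scale_left)
    next
      case False
      show ?thesis
      proof (rule conj)
        have yv: "y * v = scale s (scale (s + a) 1 + scale b i)"
        proof -
          have "y * v = scale (s * a + (a * a + b * b)) 1 + scale (s * b) i"
            by (simp add: y_def ab distrib_left distrib_right left_diff_distrib right_diff_distrib
                mult_scale_left mult_scale_right ii algebra_simps)
          then show ?thesis
            by (simp add: s algebra_simps)
        qed
        have "j * y = (scale (s + a) 1 + scale b i) * j"
          by (simp add: y_def distrib_right right_diff_distrib
              mult_scale_left mult_scale_right ji)
        then have "y * v * j = scale s (j * y)"
          by (simp add: yv mult_scale_left)
        then show "y * (1 + v * j) = (1 + scale s j) * y"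
          by (simp add: distrib_left distrib_right mult_scale_left mult.assoc)
        show "y \<in> K"
          using False by (intro LK) (simp_all add: y_def left_diff_distrib right_diff_distrib
              mult_scale_left mult_scale_right)
      qed (rule s_in)
    qed
  qed
  have "x \<in> K" if "x \<noteq> 0" for x
  proof -
    obtain p q r s where x: "x = scale p 1 + scale q i + (scale r j + scale s (i * j))"
      using quaternion_basis[OF ij, of x] by blast
    define z where "z = scale p 1 + scale q i"
    define w where "w = scale r 1 + scale s i"
    have xzw: "x = z + w * j"
      by (simp add: x z_def w_def distrib_right mult_scale_left)
    have comm: "z * i = i * z" "w * i = i * w"
      by (simp_all add: z_def w_def distrib_left distrib_right mult_scale_left mult_scale_right)
    show ?thesis
    proof (cases "z = 0")
      case True
      then show ?thesis
        using that xzw comm(2) LK j_in Km by auto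
    next
      case False
      define v where "v = inverse z * w"
      have v: "v * i = i * v"
      proof -
        have "inverse z * i = i * inverse z"
          using comm(1) by (intro mult_commute_imp_mult_inverse_commute) simp
        then show ?thesis
          unfolding v_def using comm(2) by (metis mult.assoc)
      qed
      have xv: "x = z * (1 + v * j)"
        using False by (simp add: xzw v_def distrib_left flip: mult.assoc)
      have "1 + v * j \<in> K"
        using unit[OF v] K1 by (cases "v = 0") simp_all
      then show ?thesis
        unfolding xv using LK comm(1) False Km by blast
    qed
  qed
  then show ?thesis
    using K0 by (auto simp: multiplicative_group_def)
qed

end

section \<open>Maximal subgroups of the multiplicative group\<close>

theorem theorem15:
  fixes scale :: "'f::field \<Rightarrow> 'a::division_ring \<Rightarrow> 'a"
  assumes "quaternion_division_algebra scale"
  shows "\<exists>H :: 'a set. maximal_subgroup H multiplicative_group"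
proof -
  interpret quaternion_division_algebra scale
    by fact
  note iff = subgroup_multiplicative_group_iff
  obtain N :: "'a \<Rightarrow> 'f" where mult: "\<And>x y. N (x * y) = N x * N y"
    and quad: "\<And>x y t n. x * y \<noteq> y * x \<Longrightarrow> x * x = scale t x - scale n 1 \<Longrightarrow> N x = n"
    using ex_reduced_norm by blast
  define H where "H = {x :: 'a. x \<noteq> 0 \<and> (\<exists>c. N x = c * c)}"
  have one: "\<exists>c. N 1 = c * c"
    using mult[of 1 1] unfolding mult_1_left by (rule exI)
  have H: "subgroup H multiplicative_group"
    unfolding iff
  proof (intro conjI ballI)
    show "0 \<notin> H" "1 \<in> H"
      using one by (auto simp: H_def)
    show "x * y \<in> H" if xy: "x \<in> H" "y \<in> H" for x y
    proof -
      obtain c d where "N x = c * c" "N y = d * d"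
        using xy by (auto simp: H_def)
      then have "N (x * y) = (c * d) * (c * d)"
        by (simp add: mult)
      then show ?thesis
        using xy by (auto simp: H_def)
    qed
    show "inverse x \<in> H" if x: "x \<in> H" for x
    proof -
      obtain c where c: "N x = c * c" and "x \<noteq> 0"
        using x by (auto simp: H_def)
      have "inverse x = x * (inverse x * inverse x)"
        using \<open>x \<noteq> 0\<close> by (simp flip: mult.assoc)
      then have "N (inverse x) = N (x * (inverse x * inverse x))"
        by (rule arg_cong)
      also have "\<dots> = (c * N (inverse x)) * (c * N (inverse x))"
        by (simp add: mult c)
      finally have "\<exists>d. N (inverse x) = d * d"
        by (rule exI)
      then show ?thesis
        using \<open>x \<noteq> 0\<close> by (simp add: H_def)
    qed
  qed
  show ?thesis
  proof (cases "H = carrier multiplicative_group")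
    case False
    have "x * x \<in> H" if "x \<noteq> 0" for x
      using that by (auto simp: H_def mult)
    then show ?thesis
      using group.ex_maximal_subgroup_if_squares[OF group_multiplicative_group H False]
      by (simp add: multiplicative_group_def)
  next
    case True
    have sq: "\<exists>c. N x = c * c" if "x \<noteq> 0" for x
    proof -
      have "x \<in> H"
        using that by (simp add: True multiplicative_group_def)
      then show ?thesis
        by (simp add: H_def)
    qed
    obtain i j :: 'a where ij: "i * j \<noteq> j * i"
      and gens: "i * i = - 1" "j * j = - 1" "j * i = - (i * j)"
        "\<And>a b. \<exists>c. a * a + b * b = c * (c :: 'f)"
    proof (rule ex_hamilton_generators[of N])
      show "N x = n" if "x * y \<noteq> y * x" "x * x = scale t x - scale n 1" for x y t n
        using that by (rule quad)
      show "\<exists>c. N x = c * c" if "x \<noteq> 0" for x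
        using that by (rule sq)
    qed blast
    define L where "L = {z. z \<noteq> 0 \<and> z * i = i * z}"
    have "subgroup L multiplicative_group"
      unfolding iff
    proof (intro conjI ballI)
      show "x * y \<in> L" if "x \<in> L" "y \<in> L" for x y
        using that by (simp add: L_def) (metis mult.assoc)
      show "inverse x \<in> L" if "x \<in> L" for x
        using that by (simp add: L_def mult_commute_imp_mult_inverse_commute)
    qed (simp_all add: L_def)
    moreover have "i + j \<notin> L"
      using ij by (simp add: L_def distrib_left distrib_right)
    moreover have "i + j \<in> carrier multiplicative_group"
    proof -
      have "i + j \<noteq> 0"
        using ij by (auto simp: add_eq_0_iff)
      then show ?thesis
        by (simp add: multiplicative_group_def)
    qed
    moreover have "K = carrier multiplicative_group"
      if "subgroup K multiplicative_group" "L \<subseteq> K" "i + j \<in> K" for K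
      using generated_by_centralizer_and_sum[OF ij gens that(1) _ that(3)] that(2) by (simp add: L_def)
    ultimately show ?thesis
      by (rule group.ex_maximal_subgroup_if_generated[OF group_multiplicative_group])
  qed
qed

end
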